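(* Let $k,\Delta\geq 2$ with $\Delta\leq k$, and let $T$ be any $[\Delta,k]$-transversal design. Let $a,b\geq 0$ with $a+b=\Delta_0\leq\Delta$. Suppose we are given $a$ nodes of $T$ (the target-nodes) and $b$ blocks of $T$ (the target-blocks), where repetitions are allowed among the target-nodes and among the target-blocks. Suppose $D_0$ is a group of $T$ containing no target-node. Then there exists a set $S$ of $\Delta_0$ distinct nodes of $D_0$ and $\Delta_0$ pairwise internally-disjoint paths in $T$, each of length at most $3$, whose sources are exactly the nodes of $S$ and whose destinations are exactly the target-nodes and target-blocks (with multiplicity).
   Context: A $[\Delta,k]$-transversal design ($k,\Delta\ge2$) is a set of $\Delta k$ elements partitioned into $\Delta$ groups of size $k$, with a family of $k^2$ blocks, each a $\Delta$-subset meeting every group in exactly one element, such that every pair of elements from distinct groups lies in exactly one block. It is viewed as a bipartite graph with the elements as nodes, the blocks as blocks, and a node adjacent to a block iff it belongs to it. A path is a sequence of distinct vertices with consecutive ones adjacent; its length is its number of edges. A set of paths is pairwise internally-disjoint if every source or destination appears only as a source or destination of paths in the set, and every other vertex appears on at most one of the paths. *)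

theory Defs
  imports
    "HOL-Library.Disjoint_Sets"
    "HOL-Library.Multiset"
    "Graph_Theory.Graph_Theory"
begin

text \<open>
  The blocks may be taken as a set rather than an indexed family: since \<open>\<Delta> \<ge> 2\<close>, each block
  contains two elements from distinct groups, and such a pair lies in only one block.
\<close>

locale transversal_design =
  fixes \<Delta> k :: nat
    and elems :: "'a set"
    and groups :: "'a set set"
    and blocks :: "'a set set"
  assumes two_le_\<Delta>: "2 \<le> \<Delta>"
    and two_le_k: "2 \<le> k"
    and card_elems: "card elems = \<Delta> * k"
    and groups_partition: "partition_on elems groups"
    and card_groups: "card groups = \<Delta>"
    and card_group: "\<And>D. D \<in> groups \<Longrightarrow> card D = k"
    and card_blocks: "card blocks = k\<^sup>2"
    and block_subset: "\<And>B. B \<in> blocks \<Longrightarrow> B \<subseteq> elems"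
    and card_block: "\<And>B. B \<in> blocks \<Longrightarrow> card B = \<Delta>"
    and block_meets_group: "\<And>B D. B \<in> blocks \<Longrightarrow> D \<in> groups \<Longrightarrow> \<exists>!x. x \<in> B \<inter> D"
    and pair_in_unique_block:
      "\<And>D D' x y. D \<in> groups \<Longrightarrow> D' \<in> groups \<Longrightarrow> D \<noteq> D' \<Longrightarrow> x \<in> D \<Longrightarrow> y \<in> D' \<Longrightarrow>
         \<exists>!B. B \<in> blocks \<and> x \<in> B \<and> y \<in> B"

text \<open>
  The undirected bipartite graph is represented by its symmetric arc relation; \<open>Inl\<close> tags nodes
  (elements) and \<open>Inr\<close> tags blocks.
\<close>

definition incidence_graph :: "'a set \<Rightarrow> 'a set set \<Rightarrow> ('a + 'a set) pair_pre_digraph" where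
  "incidence_graph elems blocks =
     \<lparr> pverts = Inl ` elems \<union> Inr ` blocks,
       parcs = {(Inl x, Inr B) | x B. x \<in> elems \<and> B \<in> blocks \<and> x \<in> B}
             \<union> {(Inr B, Inl x) | x B. x \<in> elems \<and> B \<in> blocks \<and> x \<in> B} \<rparr>"

text \<open>
  A path is a vertex list; its source is its first and its destination its last vertex.
\<close>

definition internally_disjoint :: "'v list set \<Rightarrow> bool" where
  "internally_disjoint P \<longleftrightarrow>
     (\<forall>v \<in> hd ` P \<union> last ` P. \<forall>p \<in> P. v \<in> set p \<longrightarrow> v = hd p \<or> v = last p) \<and>
     (\<forall>v. v \<notin> hd ` P \<union> last ` P \<longrightarrow>
        (\<forall>p \<in> P. \<forall>q \<in> P. v \<in> set p \<longrightarrow> v \<in> set q \<longrightarrow> p = q))"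

end

theory Submission
  imports Defs
begin

text \<open>
  For every element \<open>s\<close> of \<open>D\<^sub>0\<close> lying on a target block, one such block is reached directly from
  \<open>s\<close>. All other targets are assigned arbitrary further sources \<open>s \<in> D\<^sub>0\<close>, so that no block
  through such an \<open>s\<close> is a target. A target node \<open>t\<close> is reached through the block joining \<open>s\<close> and
  \<open>t\<close>; a target block \<open>B\<close> is reached via an element \<open>x \<in> B - D\<^sub>0\<close> that is not a target node and
  the block joining \<open>s\<close> and \<open>x\<close>. As at least one target block is reached directly, there are
  enough such elements to choose them distinct greedily. The joining blocks are distinct because
  a block meets \<open>D\<^sub>0\<close> in only one element.
\<close>

text \<open>A crude sufficient form of Hall's condition: when \<open>j\<close> is served after
  \<open>K\<close>, at most \<open>card K\<close> values are taken, and \<open>A j\<close> contains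
  at least one more. The sets \<open>A i\<close> may overlap arbitrarily.\<close>

lemma greedy_distinct_representatives:
  assumes "finite K" and "\<And>i. i \<in> K \<Longrightarrow> card K \<le> card (A i)"
  shows "\<exists>x. inj_on x K \<and> (\<forall>i\<in>K. x i \<in> A i)"
  using assms
proof (induction K rule: finite_induct)
  case empty
  then show ?case by simp
next
  case (insert j K)
  have "card K \<le> card (A i)" if "i \<in> K" for i
    using insert.prems[of i] insert.hyps that by simp
  then obtain x where x: "inj_on x K" "\<forall>i\<in>K. x i \<in> A i"
    using insert.IH by blast
  have "card (x ` K) < card (A j)"
    using insert.prems[of j] insert.hyps card_image_le[of K x] by simp
  then obtain y where "y \<in> A j" "y \<notin> x ` K"
    by (metis card_mono finite_imageI insert.hyps(1) not_le subsetI)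
  then have "inj_on (x(j := y)) (insert j K) \<and> (\<forall>i\<in>insert j K. (x(j := y)) i \<in> A i)"
    using x insert.hyps(2) by (auto simp: inj_on_def)
  then show ?case by blast
qed

text \<open>Serves to number the targets, so that equal targets keep separate indices.\<close>

lemma ex_indexing_mset:
  "\<exists>g. image_mset g (mset_set {..<size M}) = M"
proof -
  obtain xs where xs: "mset xs = M"
    using ex_mset by blast
  have "image_mset ((!) xs) (mset_set {..<length xs}) = mset (map ((!) xs) [0..<length xs])"
    by (simp add: atLeast0LessThan)
  also have "\<dots> = M"
    using xs by (simp only: map_nth)
  finally have "image_mset ((!) xs) (mset_set {..<size M}) = M"
    using xs by auto
  then show ?thesis by blast
qed

text \<open>Lets an explicit path be checked from its destination backwards; \<open>u\<close> is a
  vertex because both ends of every arc are.\<close>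

lemma vpath_incidence_graph_ConsI:
  assumes "vpath (v # p) (with_proj (incidence_graph elems blocks))"
    and "u \<notin> set (v # p)" and "(u, v) \<in> parcs (incidence_graph elems blocks)"
  shows "vpath (u # v # p) (with_proj (incidence_graph elems blocks))"
  using assms
  by (auto simp: vpath_def vwalk_def incidence_graph_def)

context transversal_design
begin

lemma finite_group: "D \<in> groups \<Longrightarrow> finite D"
  using card_group two_le_k by (metis card.infinite not_numeral_le_zero)

lemma elems_eq: "elems = \<Union>groups"
  using groups_partition by (simp add: partition_on_def)

lemma joining_block:
  assumes "D \<in> groups" "s \<in> D" "y \<in> elems" "y \<notin> D"
  shows "\<exists>B\<in>blocks. s \<in> B \<and> y \<in> B"
  using assms pair_in_unique_block elems_eq by (metis UnionE)

lemma card_block_minus_group: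
  assumes "B \<in> blocks" "D \<in> groups"
  shows "card (B - D) = \<Delta> - 1"
proof -
  obtain s where "B \<inter> D = {s}"
    using block_meets_group[OF assms] by blast
  then have "B - D = B - {s}" "s \<in> B" by auto
  then show ?thesis
    using card_block[OF assms(1)] by simp
qed

text \<open>The core of the theorem, with the targets listed as \<open>g 0\<close>, ...,
  \<open>g (n - 1)\<close>. Multiplicities become repeated values of \<open>g\<close>, and sources
  and paths are functions of the index.\<close>

lemma ex_disjoint_paths_to_indexed_targets:
  fixes g :: "nat \<Rightarrow> 'a + 'a set"
  assumes "\<Delta> \<le> k" and n: "n \<le> \<Delta>" and D: "D \<in> groups"
    and nodes: "\<And>i t. i < n \<Longrightarrow> g i = Inl t \<Longrightarrow> t \<in> elems - D"
    and blks: "\<And>i B. i < n \<Longrightarrow> g i = Inr B \<Longrightarrow> B \<in> blocks"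
  shows "\<exists>p \<sigma>. inj_on \<sigma> {..<n} \<and> \<sigma> ` {..<n} \<subseteq> D \<and>
    (\<forall>i<n. vpath (p i) (with_proj (incidence_graph elems blocks)) \<and> vwalk_length (p i) \<le> 3 \<and>
           hd (p i) = Inl (\<sigma> i) \<and> last (p i) = g i) \<and>
    internally_disjoint (p ` {..<n})"
proof -
  define tb where "tb = {i. i < n \<and> \<not> isl (g i)}"
  define tn where "tn = {i. i < n \<and> isl (g i)}"
  define T where "T = (projl \<circ> g) ` tn"
  define f where "f B = (THE s. s \<in> B \<inter> D)" for B
  have f: "f B \<in> B \<inter> D" if "B \<in> blocks" for B
    unfolding f_def using block_meets_group[OF that D] by (rule theI')
  have f_unique: "s = f B" if "B \<in> blocks" "s \<in> B" "s \<in> D" for B s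
    using block_meets_group[OF that(1) D] f[OF that(1)] that by blast
  have tb_block: "projr (g i) \<in> blocks" "g i = Inr (projr (g i))" if "i \<in> tb" for i
    using that blks[of i "projr (g i)"] by (auto simp: tb_def)
  have tn_node: "projl (g i) \<in> elems - D" "g i = Inl (projl (g i))" "projl (g i) \<in> T"
    if "i \<in> tn" for i
    using that nodes[of i "projl (g i)"] by (auto simp: tn_def T_def)
  have fin: "finite tb" "finite tn" and T_fin: "finite T"
    by (auto simp: tb_def tn_def T_def)
  have split: "{..<n} = tb \<union> tn" "tb \<inter> tn = {}"
    by (auto simp: tb_def tn_def)
  have card_split: "card tb + card tn = n"
    using card_Un_disjoint[OF fin split(2)] by (simp flip: split(1))
  \<comment> \<open>\<open>R\<close> consists of the elements of \<open>D\<close> that lie on some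
    target block.\<close>
  define R where "R = (\<lambda>i. f (projr (g i))) ` tb"
  have R: "R \<subseteq> D"
    using f tb_block by (auto simp: R_def)
  \<comment> \<open>\<open>J\<close> selects exactly one index for each element of \<open>R\<close>:
    the target blocks reached by a single edge. A repeated target block, or a second one through the
    same element of \<open>D\<close>, stays outside \<open>J\<close>.\<close>
  obtain J where J: "J \<subseteq> tb" "inj_on (\<lambda>i. f (projr (g i))) J" "R = (\<lambda>i. f (projr (g i))) ` J"
    using subset_image_inj[of R "\<lambda>i. f (projr (g i))" tb] by (auto simp: R_def)
  have J_fin: "finite J"
    using J(1) fin(1) finite_subset by blast
  have card_JR: "card R = card J"
    using J by (simp add: card_image)
  \<comment> \<open>At least \<Delta> - 1 - \<open>card tn\<close> candidates are left on each
    block. As \<open>card tb + card tn = n\<close> \<le> \<Delta>, this is at least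
    \<open>card tb - 1\<close>, which suffices once \<open>J\<close> is nonempty.\<close>
  have "card (tb - J) \<le> card (projr (g i) - D - T)" if i: "i \<in> tb - J" for i
  proof -
    have "J \<noteq> {}"
      using i J(3) by (auto simp: R_def)
    then have "card (tb - J) \<le> card tb - 1"
      using J J_fin by (simp add: card_Diff_subset card_gt_0_iff Suc_leI diff_le_mono2)
    moreover have "card T \<le> card tn"
      unfolding T_def using fin(2) card_image_le by blast
    moreover have "card (projr (g i) - D) = \<Delta> - 1"
      using card_block_minus_group D tb_block i by blast
    moreover have "card (projr (g i) - D) - card T \<le> card (projr (g i) - D - T)"
      using diff_card_le_card_Diff T_fin by blast
    ultimately show ?thesis
      using card_split n by linarith
  qed
  then obtain x where x: "inj_on x (tb - J)" "\<And>i. i \<in> tb - J \<Longrightarrow> x i \<in> projr (g i) - D - T"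
    using greedy_distinct_representatives[of "tb - J" "\<lambda>i. projr (g i) - D - T"] fin(1) by auto
  \<comment> \<open>Here \<Delta> \<le> \<open>k\<close> enters: \<open>D\<close> has room for
    \<open>n\<close> distinct sources, of which \<open>R\<close> provides
    \<open>card J\<close>.\<close>
  have "card ({..<n} - J) \<le> card (D - R)"
  proof -
    have "J \<subseteq> {..<n}" using J(1) split by blast
    then have "card ({..<n} - J) = n - card J"
      using J_fin by (simp add: card_Diff_subset)
    moreover have "card (D - R) = k - card J"
      using card_JR R finite_group[OF D] card_group[OF D]
      by (simp add: card_Diff_subset finite_subset)
    ultimately show ?thesis using n assms(1) by linarith
  qed
  then obtain h where h: "h ` ({..<n} - J) \<subseteq> D - R" "inj_on h ({..<n} - J)"
    using card_le_inj[of "{..<n} - J" "D - R"] finite_group[OF D] by auto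
  define \<sigma> where "\<sigma> i = (if i \<in> J then f (projr (g i)) else h i)" for i
  have \<sigma>_J: "\<sigma> i \<in> projr (g i)" if "i \<in> J" for i
    using that J(1) tb_block f by (auto simp: \<sigma>_def)
  have \<sigma>_R: "\<sigma> i \<in> R \<longleftrightarrow> i \<in> J" if "i < n" for i
    using that h J by (auto simp: \<sigma>_def)
  have \<sigma>_D: "\<sigma> i \<in> D" if "i < n" for i
    using that h R J(3) by (auto simp: \<sigma>_def)
  have \<sigma>_inj: "inj_on \<sigma> {..<n}"
  proof (rule inj_onI)
    fix i j assume *: "i \<in> {..<n}" "j \<in> {..<n}" "\<sigma> i = \<sigma> j"
    then have "i \<in> J \<longleftrightarrow> j \<in> J" using \<sigma>_R by (metis lessThan_iff)
    then show "i = j"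
      using * J(2) h(2) by (auto simp: \<sigma>_def inj_on_def split: if_splits)
  qed
  \<comment> \<open>The node that must be joined to \<open>\<sigma> i\<close>: the intermediate node
    or the target itself. Its value matters only for \<open>i\<close> outside
    \<open>J\<close>.\<close>
  define y where "y i = (if i \<in> tb then x i else projl (g i))" for i
  have y: "y i \<in> elems" "y i \<notin> D" if "i < n" "i \<notin> J" for i
  proof -
    have "i \<in> tb \<or> i \<in> tn" using that split by blast
    then show "y i \<in> elems" "y i \<notin> D"
      using that x(2)[of i] tn_node(1)[of i] tb_block(1)[of i] block_subset split(2)
      by (auto simp: y_def)
  qed
  define \<beta> where "\<beta> i = (SOME B. B \<in> blocks \<and> \<sigma> i \<in> B \<and> y i \<in> B)" for i
  have \<beta>: "\<beta> i \<in> blocks" "\<sigma> i \<in> \<beta> i" "y i \<in> \<beta> i" if "i < n" "i \<notin> J" for i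
  proof -
    have "\<exists>B. B \<in> blocks \<and> \<sigma> i \<in> B \<and> y i \<in> B"
      using joining_block[OF D \<sigma>_D y] that by blast
    from someI_ex[OF this] show "\<beta> i \<in> blocks" "\<sigma> i \<in> \<beta> i" "y i \<in> \<beta> i"
      by (auto simp: \<beta>_def)
  qed
  have \<beta>_inj: "i = j" if "i < n" "i \<notin> J" "j < n" "j \<notin> J" "\<beta> i = \<beta> j" for i j
    \<comment> \<open>The block \<open>\<beta> i\<close> meets \<open>D\<close> in
      \<open>\<sigma> i\<close> alone, so it determines \<open>\<sigma> i\<close> and hence
      \<open>i\<close>.\<close>
    using that \<beta> \<sigma>_D \<sigma>_inj f_unique by (metis inj_onD lessThan_iff)
  \<comment> \<open>Were \<open>\<beta> i\<close> a target, its element \<open>\<sigma> i\<close> of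
    \<open>D\<close> would belong to \<open>R\<close>; but sources for indices outside
    \<open>J\<close> avoid \<open>R\<close>.\<close>
  have \<beta>_not_target: "g j \<noteq> Inr (\<beta> i)" if "i < n" "i \<notin> J" "j < n" for i j
  proof
    assume *: "g j = Inr (\<beta> i)"
    then have "j \<in> tb" using that by (simp add: tb_def)
    moreover have "\<sigma> i = f (\<beta> i)"
      using that \<beta> \<sigma>_D f_unique by blast
    ultimately have "\<sigma> i \<in> R"
      using * by (force simp: R_def)
    then show False using \<sigma>_R that by blast
  qed
  have x_not_target: "g j \<noteq> Inl (x i)" if "i \<in> tb - J" "j < n" for i j
    using x(2)[OF that(1)] tn_node(3)[of j] that(2) by (auto simp: tn_def)
  \<comment> \<open>The three shapes have lengths 1, 3 and 2.\<close>
  define p where "p i = (if i \<in> J then [Inl (\<sigma> i), g i]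
    else if i \<in> tb then [Inl (\<sigma> i), Inr (\<beta> i), Inl (x i), g i]
    else [Inl (\<sigma> i), Inr (\<beta> i), g i])" for i
  have hd_p: "hd (p i) = Inl (\<sigma> i)" and last_p: "last (p i) = g i"
    and length_p: "vwalk_length (p i) \<le> 3" for i
    by (auto simp: p_def)
  have D_elems: "D \<subseteq> elems"
    using D elems_eq by blast
  have single: "vpath [v] (with_proj (incidence_graph elems blocks))"
    if "v \<in> Inl ` elems \<union> Inr ` blocks" for v
    using that by (auto simp: vpath_def vwalk_def incidence_graph_def)
  have arcs: "(Inl z, Inr B) \<in> parcs (incidence_graph elems blocks)"
    "(Inr B, Inl z) \<in> parcs (incidence_graph elems blocks)"
    if "B \<in> blocks" "z \<in> B" for z B
    using that block_subset by (auto simp: incidence_graph_def)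
  have path_p: "vpath (p i) (with_proj (incidence_graph elems blocks))" if i: "i < n" for i
  proof -
    consider "i \<in> J" "i \<in> tb" | "i \<notin> J" "i \<in> tb" | "i \<notin> J" "i \<notin> tb" "i \<in> tn"
      using J(1) split i by blast
    then show ?thesis
    proof cases
      case 1
      define B where "B = projr (g i)"
      have B: "g i = Inr B" "B \<in> blocks" "\<sigma> i \<in> B"
        using 1 tb_block \<sigma>_J by (auto simp: B_def)
      then show ?thesis
        using 1 by (auto simp: p_def intro!: vpath_incidence_graph_ConsI single arcs)
    next
      case 2
      define B where "B = projr (g i)"
      have B: "g i = Inr B" "B \<in> blocks" "x i \<in> B" "x i \<notin> D" "x i \<in> \<beta> i"
        using 2 tb_block x(2)[of i] \<beta>(3)[OF i] by (auto simp: B_def y_def)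
      moreover have "\<beta> i \<noteq> B" "\<sigma> i \<noteq> x i"
        using \<beta>_not_target[OF i _ i] 2 B \<sigma>_D[OF i] by auto
      ultimately show ?thesis
        using 2 \<beta>[OF i] by (auto simp: p_def intro!: vpath_incidence_graph_ConsI single arcs)
    next
      case 3
      define t where "t = projl (g i)"
      have "g i = Inl t" "t \<in> elems" "t \<notin> D" "t \<in> \<beta> i"
        using 3 tn_node[of i] \<beta>(3)[OF i] by (auto simp: t_def y_def)
      moreover have "\<sigma> i \<noteq> t"
        using calculation \<sigma>_D[OF i] by auto
      ultimately show ?thesis
        using 3 \<beta>[OF i] by (auto simp: p_def intro!: vpath_incidence_graph_ConsI single arcs)
    qed
  qed
  have set_p: "v = Inl (\<sigma> i) \<or> v = g i \<or> i \<notin> J \<and> v = Inr (\<beta> i) \<or> i \<in> tb - J \<and> v = Inl (x i)"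
    if "v \<in> set (p i)" for v i
    using that by (auto simp: p_def split: if_splits)
  have ends: "hd ` p ` {..<n} \<union> last ` p ` {..<n} = (\<lambda>i. Inl (\<sigma> i)) ` {..<n} \<union> g ` {..<n}"
    by (auto simp: image_image hd_p last_p)
  have "internally_disjoint (p ` {..<n})"
    unfolding internally_disjoint_def ends
  proof (intro conjI ballI allI impI; (elim imageE)?)
    \<comment> \<open>No inner vertex is an end of any path: \<open>\<beta> i\<close> is not a
      target, and \<open>x i\<close> lies outside both \<open>D\<close> and
      \<open>T\<close>.\<close>
    fix v q i
    assume v: "v \<in> (\<lambda>i. Inl (\<sigma> i)) ` {..<n} \<union> g ` {..<n}" "v \<in> set q"
      and q: "q = p i" "i \<in> {..<n}"
    have "v \<noteq> Inr (\<beta> i)" if "i \<notin> J"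
      using v(1) \<beta>_not_target[of i] that q(2) by force
    moreover have "v \<noteq> Inl (x i)" if "i \<in> tb - J"
      using v(1) x_not_target[OF that] x(2)[OF that] \<sigma>_D by force
    ultimately show "v = hd q \<or> v = last q"
      using set_p[of v i] v q by (auto simp: hd_p last_p)
  next
    \<comment> \<open>The tags keep inner blocks and inner nodes apart, so a shared inner vertex is
      a common value of \<open>\<beta>\<close> or of \<open>x\<close>, each injective on its
      indices.\<close>
    fix v q r i j
    assume v: "v \<notin> (\<lambda>i. Inl (\<sigma> i)) ` {..<n} \<union> g ` {..<n}" "v \<in> set q" "v \<in> set r"
      and q: "q = p i" "i \<in> {..<n}" and r: "r = p j" "j \<in> {..<n}"
    have "i \<notin> J \<and> v = Inr (\<beta> i) \<or> i \<in> tb - J \<and> v = Inl (x i)"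
      using set_p[of v i] v q by auto
    moreover have "j \<notin> J \<and> v = Inr (\<beta> j) \<or> j \<in> tb - J \<and> v = Inl (x j)"
      using set_p[of v j] v r by auto
    ultimately have "i = j"
      using \<beta>_inj q(2) r(2) x(1) by (auto dest: inj_onD)
    then show "q = r" using q r by simp
  qed
  then show ?thesis
    using \<sigma>_inj \<sigma>_D path_p length_p hd_p last_p by (intro exI[of _ p] exI[of _ \<sigma>]) auto
qed

end

theorem theorem4:
  fixes \<Delta> k a b \<Delta>\<^sub>0 :: nat
    and elems D\<^sub>0 :: "'a set"
    and groups blocks :: "'a set set"
    and target_nodes :: "'a multiset"
    and target_blocks :: "'a set multiset"
  assumes "2 \<le> k" and "2 \<le> \<Delta>" and "\<Delta> \<le> k"
    and "transversal_design \<Delta> k elems groups blocks"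
    and "a + b = \<Delta>\<^sub>0" and "\<Delta>\<^sub>0 \<le> \<Delta>"
    and "set_mset target_nodes \<subseteq> elems" and "size target_nodes = a"
    and "set_mset target_blocks \<subseteq> blocks" and "size target_blocks = b"
    and "D\<^sub>0 \<in> groups" and "D\<^sub>0 \<inter> set_mset target_nodes = {}"
  shows "\<exists>(S :: 'a set) (P :: ('a + 'a set) list set).
    S \<subseteq> D\<^sub>0 \<and> card S = \<Delta>\<^sub>0 \<and>
    finite P \<and> card P = \<Delta>\<^sub>0 \<and>
    (\<forall>p \<in> P. vpath p (with_proj (incidence_graph elems blocks)) \<and> vwalk_length p \<le> 3) \<and>
    internally_disjoint P \<and>
    hd ` P = Inl ` S \<and>
    image_mset last (mset_set P) = image_mset Inl target_nodes + image_mset Inr target_blocks"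
proof -
  interpret transversal_design \<Delta> k elems groups blocks
    by fact
  define M where "M = image_mset Inl target_nodes + image_mset Inr target_blocks"
  have size_M: "size M = \<Delta>\<^sub>0"
    using assms by (simp add: M_def)
  then obtain g where g: "image_mset g (mset_set {..<\<Delta>\<^sub>0}) = M"
    using ex_indexing_mset[of M] by auto
  have g_mem: "g i \<in> Inl ` set_mset target_nodes \<union> Inr ` set_mset target_blocks" if "i < \<Delta>\<^sub>0" for i
  proof -
    have "g i \<in> set_mset M"
      using that by (simp flip: g)
    then show ?thesis by (simp add: M_def)
  qed
  obtain p \<sigma> where inj: "inj_on \<sigma> {..<\<Delta>\<^sub>0}" and sub: "\<sigma> ` {..<\<Delta>\<^sub>0} \<subseteq> D\<^sub>0"
    and p: "\<forall>i<\<Delta>\<^sub>0. vpath (p i) (with_proj (incidence_graph elems blocks)) \<and>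
      vwalk_length (p i) \<le> 3 \<and> hd (p i) = Inl (\<sigma> i) \<and> last (p i) = g i"
    and disj: "internally_disjoint (p ` {..<\<Delta>\<^sub>0})"
  proof -
    have "t \<in> elems - D\<^sub>0" if "i < \<Delta>\<^sub>0" "g i = Inl t" for i t
      using g_mem[OF that(1)] that(2) assms by auto
    moreover have "B \<in> blocks" if "i < \<Delta>\<^sub>0" "g i = Inr B" for i B
      using g_mem[OF that(1)] that(2) assms by auto
    ultimately show thesis
      using ex_disjoint_paths_to_indexed_targets[of \<Delta>\<^sub>0 D\<^sub>0 g] assms that by blast
  qed
  \<comment> \<open>Distinct sources keep the paths distinct even when targets repeat, so passing to
    the set of paths loses no multiplicity.\<close>
  have inj_p: "inj_on p {..<\<Delta>\<^sub>0}"
    using inj p by (metis (no_types, lifting) inj_on_def lessThan_iff sum.inject(1))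
  have "image_mset last (mset_set (p ` {..<\<Delta>\<^sub>0})) = image_mset (last \<circ> p) (mset_set {..<\<Delta>\<^sub>0})"
    using inj_p by (simp add: image_mset.compositionality flip: image_mset_mset_set)
  also have "\<dots> = image_mset g (mset_set {..<\<Delta>\<^sub>0})"
    using p by (intro image_mset_cong) simp
  finally have "image_mset last (mset_set (p ` {..<\<Delta>\<^sub>0})) = M"
    using g by simp
  moreover have "hd ` p ` {..<\<Delta>\<^sub>0} = Inl ` \<sigma> ` {..<\<Delta>\<^sub>0}"
    using p by (simp add: image_image)
  ultimately show ?thesis
    using inj sub p disj inj_p unfolding M_def
    by (intro exI[of _ "\<sigma> ` {..<\<Delta>\<^sub>0}"] exI[of _ "p ` {..<\<Delta>\<^sub>0}"]) (auto simp: card_image)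
qed

end
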